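(* Let $q:\mathbb{R}^n\to\mathbb{R}^M$, $p:\mathbb{R}^M\to\mathbb{R}^\ell$, $C\in\mathbb{R}^{\ell\times n}$, and let $e(x)=p(q(x))-Cx$. Let $x_d\in\mathbb{R}^n$, $r>0$, $L\geq 0$, and assume that $e$ is locally $L$-Lipschitz for radius $r$ around $x_d$, i.e. $\|e(x)-e(y)\|\le L\|x-y\|$ for all $x,y\in B_r(x_d)$. Further assume that the true maximum slope $$S_{x_d}:=\max_{x\in B_r(x_d)}s(x,x_d)$$ is achieved by a point whose distance from $x_d$ is greater than $\tau$, where $0<\tau\le r$. Let $\varepsilon>0$, let $\mathcal{S}_{x_d}\subset B_r(x_d)$ be a finite $\varepsilon$-covering of $B_r(x_d)$, and let $$\widehat S_{x_d}=\max_{x_i\in\mathcal{S}_{x_d}}s(x_i,x_d).$$ Then $$S_{x_d}\le\widehat S_{x_d}\left(1+\frac{\varepsilon}{\tau}\right)+L\,\frac{\varepsilon}{\tau}.$$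
   Context: $\|\cdot\|$ denotes fixed norms on $\mathbb{R}^n$ and $\mathbb{R}^\ell$, and $B_r(x_0)=\{x:\|x-x_0\|\le r\}$. The slope is $s(x,x')=\|e(x)-e(x')\|/\|x-x'\|$ for $x\ne x'$, with the convention $s(x,x)=0$. An $\varepsilon$-covering of a set $B$ is a subset such that every point of $B$ is at distance at most $\varepsilon$ from some point of the subset. $q$ is the generative model (observation $z=q(x)$) and $p$ is the perception map predicting $Cx$ from $z$. *)

theory Defs
  imports "HOL-Analysis.Analysis"
begin

text \<open>
  The norms on \<open>\<real>\<^sup>n\<close> and \<open>\<real>\<^sup>\<ell>\<close> are arbitrary, whereas \<^const>\<open>norm\<close> on \<^typ>\<open>real ^ 'n\<close> is the
  Euclidean one. They are therefore explicit functions, and balls, Lipschitz continuity and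
  coverings are stated relative to them.
\<close>

definition is_norm :: "('a::real_vector \<Rightarrow> real) \<Rightarrow> bool" where
  "is_norm N \<longleftrightarrow>
     (\<forall>x. 0 \<le> N x) \<and>
     (\<forall>x. N x = 0 \<longleftrightarrow> x = 0) \<and>
     (\<forall>a x. N (a *\<^sub>R x) = \<bar>a\<bar> * N x) \<and>
     (\<forall>x y. N (x + y) \<le> N x + N y)"

definition norm_ball :: "('a::real_vector \<Rightarrow> real) \<Rightarrow> real \<Rightarrow> 'a \<Rightarrow> 'a set" where
  "norm_ball N r x0 = {x. N (x - x0) \<le> r}"

definition perception_error ::
  "(real ^ 'm \<Rightarrow> real ^ 'l) \<Rightarrow> (real ^ 'n \<Rightarrow> real ^ 'm) \<Rightarrow> real ^ 'n ^ 'l \<Rightarrow>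
   real ^ 'n \<Rightarrow> real ^ 'l" where
  "perception_error p q C x = p (q x) - C *v x"

definition locally_lipschitz ::
  "('a::real_vector \<Rightarrow> real) \<Rightarrow> ('b::real_vector \<Rightarrow> real) \<Rightarrow> ('a \<Rightarrow> 'b) \<Rightarrow>
   real \<Rightarrow> real \<Rightarrow> 'a \<Rightarrow> bool" where
  "locally_lipschitz N N' e L r x0 \<longleftrightarrow>
     (\<forall>x \<in> norm_ball N r x0. \<forall>y \<in> norm_ball N r x0. N' (e x - e y) \<le> L * N (x - y))"

definition slope ::
  "('a::real_vector \<Rightarrow> real) \<Rightarrow> ('b::real_vector \<Rightarrow> real) \<Rightarrow> ('a \<Rightarrow> 'b) \<Rightarrow>
   'a \<Rightarrow> 'a \<Rightarrow> real" where
  "slope N N' e x x' = (if x = x' then 0 else N' (e x - e x') / N (x - x'))"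

definition eps_covering :: "('a::real_vector \<Rightarrow> real) \<Rightarrow> real \<Rightarrow> 'a set \<Rightarrow> 'a set \<Rightarrow> bool" where
  "eps_covering N \<epsilon> A B \<longleftrightarrow> A \<subseteq> B \<and> (\<forall>x \<in> B. \<exists>y \<in> A. N (x - y) \<le> \<epsilon>)"

text \<open>
  \<^const>\<open>Max\<close> is meaningful on finite sets only, hence \<^const>\<open>Greatest\<close> for the ball. The value is
  unspecified if the slope has no maximum on the ball.
\<close>

definition max_slope ::
  "('a::real_vector \<Rightarrow> real) \<Rightarrow> ('b::real_vector \<Rightarrow> real) \<Rightarrow> ('a \<Rightarrow> 'b) \<Rightarrow>
   real \<Rightarrow> 'a \<Rightarrow> real" where
  "max_slope N N' e r x0 = (GREATEST s. s \<in> (\<lambda>x. slope N N' e x x0) ` norm_ball N r x0)"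

definition sampled_max_slope ::
  "('a::real_vector \<Rightarrow> real) \<Rightarrow> ('b::real_vector \<Rightarrow> real) \<Rightarrow> ('a \<Rightarrow> 'b) \<Rightarrow>
   'a set \<Rightarrow> 'a \<Rightarrow> real" where
  "sampled_max_slope N N' e A x0 = Max ((\<lambda>x. slope N N' e x x0) ` A)"

end

theory Submission
  imports Defs
begin

text \<open>
  Move from the maximiser \<open>x\<close> to a covering point \<open>y\<close> with \<open>N (x - y) \<le> \<epsilon>\<close>. The error at \<open>x\<close>,
  relative to \<open>x\<^sub>d\<close>, is at most \<open>L \<epsilon>\<close> plus the error at \<open>y\<close>, and the latter is at most
  the sampled slope times \<open>N (y - x\<^sub>d) \<le> N (x - x\<^sub>d) + \<epsilon>\<close>. Now divide by \<open>N (x - x\<^sub>d) > \<tau>\<close>.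
\<close>

lemma is_norm_nonneg: "is_norm N \<Longrightarrow> 0 \<le> N x"
  by (simp add: is_norm_def)

lemma is_norm_eq_0_iff: "is_norm N \<Longrightarrow> N x = 0 \<longleftrightarrow> x = 0"
  by (simp add: is_norm_def)

lemma is_norm_minus_commute:
  assumes "is_norm N"
  shows "N (x - y) = N (y - x)"
proof -
  have "N ((-1) *\<^sub>R (y - x)) = \<bar>-1\<bar> * N (y - x)"
    using assms unfolding is_norm_def by blast
  then show ?thesis by simp
qed

lemma is_norm_diff_triangle:
  assumes "is_norm N"
  shows "N (x - z) \<le> N (x - y) + N (y - z)"
proof -
  have "N ((x - y) + (y - z)) \<le> N (x - y) + N (y - z)"
    using assms unfolding is_norm_def by blast
  then show ?thesis by simp
qed

lemma slope_nonneg: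
  "is_norm N \<Longrightarrow> is_norm N' \<Longrightarrow> 0 \<le> slope N N' e x y"
  by (simp add: slope_def is_norm_nonneg)

text \<open>Clears the denominator without a side condition: for \<open>x = y\<close> the convention
  in \<open>slope\<close> gives 0 on the left, and \<open>N' 0 = 0\<close> on the right. This lets
  the covering point chosen later coincide with \<open>x\<^sub>d\<close>.\<close>

lemma slope_times_norm:
  assumes "is_norm N" "is_norm N'"
  shows "slope N N' e x y * N (x - y) = N' (e x - e y)"
  using assms by (auto simp: slope_def is_norm_eq_0_iff)

text \<open>An attained maximum is what gives the \<open>GREATEST\<close> in
  \<open>max_slope\<close> a definite value.\<close>

lemma max_slope_eq:
  assumes "is_arg_max (\<lambda>y. slope N N' e y x0) (\<lambda>y. y \<in> norm_ball N r x0) x"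
  shows "max_slope N N' e r x0 = slope N N' e x x0"
  unfolding max_slope_def
  using assms by (intro Greatest_equality) (auto simp: is_arg_max_linorder)

theorem proposition3p2:
  fixes q :: "real ^ 'n \<Rightarrow> real ^ 'm"
    and p :: "real ^ 'm \<Rightarrow> real ^ 'l"
    and C :: "real ^ 'n ^ 'l"
    and N :: "real ^ 'n \<Rightarrow> real"
    and N' :: "real ^ 'l \<Rightarrow> real"
    and e :: "real ^ 'n \<Rightarrow> real ^ 'l"
    and x\<^sub>d :: "real ^ 'n"
    and r L \<tau> \<epsilon> :: real
    and A :: "(real ^ 'n) set"
  assumes "is_norm N" and "is_norm N'"
    and "e = perception_error p q C"
    and "0 < r" and "0 \<le> L"
    and "locally_lipschitz N N' e L r x\<^sub>d"
    and "0 < \<tau>" and "\<tau> \<le> r"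
    and "\<exists>x. is_arg_max (\<lambda>y. slope N N' e y x\<^sub>d) (\<lambda>y. y \<in> norm_ball N r x\<^sub>d) x \<and> \<tau> < N (x - x\<^sub>d)"
    and "0 < \<epsilon>"
    and "finite A" and "eps_covering N \<epsilon> A (norm_ball N r x\<^sub>d)"
  shows "max_slope N N' e r x\<^sub>d \<le> sampled_max_slope N N' e A x\<^sub>d * (1 + \<epsilon> / \<tau>) + L * (\<epsilon> / \<tau>)"
proof -
  obtain x where x: "is_arg_max (\<lambda>y. slope N N' e y x\<^sub>d) (\<lambda>y. y \<in> norm_ball N r x\<^sub>d) x"
    and \<tau>: "\<tau> < N (x - x\<^sub>d)"
    using assms(9) by blast
  have xB: "x \<in> norm_ball N r x\<^sub>d"
    using x by (simp add: is_arg_max_def)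
  then obtain y where y: "y \<in> A" "y \<in> norm_ball N r x\<^sub>d" "N (x - y) \<le> \<epsilon>"
    using assms(12) unfolding eps_covering_def by blast
  define d where "d = N (x - x\<^sub>d)"
  define S where "S = sampled_max_slope N N' e A x\<^sub>d"
  have "0 < d" and "\<tau> \<le> d"
    using \<tau> \<open>0 < \<tau>\<close> by (auto simp: d_def)
  have yS: "slope N N' e y x\<^sub>d \<le> S"
    unfolding S_def sampled_max_slope_def using \<open>finite A\<close> y(1) by (intro Max_ge) auto
  \<comment> \<open>The sign of \<open>S\<close> matters twice: for enlarging
    \<open>N (y - x\<^sub>d)\<close> to \<open>d + \<epsilon>\<close> in a product, and for
    replacing \<open>d\<close> by \<open>\<tau>\<close> at the end.\<close>
  then have "0 \<le> S"
    using slope_nonneg[OF assms(1,2)] order_trans by blast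
  \<comment> \<open>The local Lipschitz bound applies because covering points lie in the ball
    themselves.\<close>
  have lip: "N' (e x - e y) \<le> L * \<epsilon>"
    using assms(6) xB y \<open>0 \<le> L\<close> unfolding locally_lipschitz_def
    by (meson mult_left_mono order_trans)
  have "N (y - x\<^sub>d) \<le> d + \<epsilon>"
    using is_norm_diff_triangle[OF assms(1), of y x\<^sub>d x] is_norm_minus_commute[OF assms(1), of x y] y(3)
    by (simp add: d_def)
  then have "N' (e y - e x\<^sub>d) \<le> S * (d + \<epsilon>)"
    unfolding slope_times_norm[OF assms(1,2), of e y, symmetric]
    using yS \<open>0 \<le> S\<close> is_norm_nonneg[OF assms(1)] by (intro mult_mono)
  then have "N' (e x - e x\<^sub>d) \<le> L * \<epsilon> + S * (d + \<epsilon>)"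
    using lip is_norm_diff_triangle[OF assms(2), of "e x" "e x\<^sub>d" "e y"] by linarith
  then have "slope N N' e x x\<^sub>d * d \<le> L * \<epsilon> + S * (d + \<epsilon>)"
    using slope_times_norm[OF assms(1,2), of e x x\<^sub>d] by (simp add: d_def)
  then have "slope N N' e x x\<^sub>d \<le> S * (1 + \<epsilon> / d) + L * (\<epsilon> / d)"
    using \<open>0 < d\<close> by (simp add: field_simps)
  \<comment> \<open>With \<open>S\<close>, \<open>L\<close> and \<open>\<epsilon>\<close>
    nonnegative, the bound can only grow when \<open>d\<close> shrinks to
    \<open>\<tau>\<close>.\<close>
  also have "\<dots> \<le> S * (1 + \<epsilon> / \<tau>) + L * (\<epsilon> / \<tau>)"
    using \<open>\<tau> \<le> d\<close> \<open>0 < \<tau>\<close> \<open>0 < \<epsilon>\<close> \<open>0 \<le> S\<close> \<open>0 \<le> L\<close>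
    by (intro add_mono mult_left_mono divide_left_mono) auto
  finally show ?thesis
    by (simp add: max_slope_eq[OF x] S_def)
qed

end
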